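(* Let $q_1,q_2,q_3$ be LDQL queries, let $V$ be a finite set of variables, $U$ a finite set of URIs, and $?v$ a variable. The following semantic equivalences hold: (1) $(q_1\,\mathsf{AND}\,(q_2\,\mathsf{UNION}\,q_3))\equiv((q_1\,\mathsf{AND}\,q_2)\,\mathsf{UNION}\,(q_1\,\mathsf{AND}\,q_3))$; (2) $\pi_V(q_1\,\mathsf{UNION}\,q_2)\equiv(\pi_Vq_1\,\mathsf{UNION}\,\pi_Vq_2)$; (3) $(\mathsf{SEED}\ U\ (q_1\,\mathsf{UNION}\,q_2))\equiv((\mathsf{SEED}\ U\ q_1)\,\mathsf{UNION}\,(\mathsf{SEED}\ U\ q_2))$; (4) $(\mathsf{SEED}\ ?v\ (q_1\,\mathsf{UNION}\,q_2))\equiv((\mathsf{SEED}\ ?v\ q_1)\,\mathsf{UNION}\,(\mathsf{SEED}\ ?v\ q_2))$.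
   Context: **Data model.** $\mathcal U$ (URIs), $\mathcal B$ (blank nodes), $\mathcal L$ (literals), $\mathcal V$ (variables, written $?v,?x,\dots$) and $\mathcal D$ (documents) are pairwise disjoint infinite sets. An RDF triple is an element of $\mathcal T=(\mathcal U\cup\mathcal B)\times\mathcal U\times(\mathcal U\cup\mathcal B\cup\mathcal L)$; $\mathrm{uris}(t)$ is the set of URIs in the triple $t$. Each document $d$ carries a finite set of triples $\mathrm{data}(d)\subseteq\mathcal T$, distinct documents using disjoint sets of blank nodes. A Web of Linked Data is $W=\langle D,adoc\rangle$ with $D\subseteq\mathcal D$ finite and $adoc:\mathcal U\to D$ a partial surjective function with domain $\mathrm{dom}(adoc)$. The link graph $\mathcal G_W$ has node set $D$ and edges $\langle d,(t,u),d'\rangle$ for all $d\in D$, $t\in\mathrm{data}(d)$, $u\in\mathrm{uris}(t)\cap\mathrm{dom}(adoc)$, $d'=adoc(u)$. **SPARQL.** A solution mapping $\mu$ is a partial function with finite domain from $\mathcal V$ to $\mathcal U\cup\mathcal B\cup\mathcal L$; $\mu[\alpha]=\mu(\alpha)$ if $\alpha\in\mathrm{dom}(\mu)$, else $\mu[\alpha]=\alpha$ (extended componentwise to triples). $\mu,\mu'$ are compatible if they agree on $\mathrm{dom}(\mu)\cap\mathrm{dom}(\mu')$. $\Omega_1\Join\Omega_2=\{\mu_1\cup\mu_2\mid\mu_i\in\Omega_i\text{ compatible}\}$. An RDF dataset $\mathfrak D$ consists of a default graph and finitely or infinitely many named graphs $\langle u,G_u\rangle$ with pairwise distinct names $u\in\mathcal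 U$. Graph patterns: finite sets $B$ of triple patterns from $(\mathcal U\cup\mathcal L\cup\mathcal V)\times(\mathcal U\cup\mathcal V)\times(\mathcal U\cup\mathcal L\cup\mathcal V)$ (basic graph patterns, possibly the empty one $\{\,\}$; a triple pattern is identified with a singleton), and $(P_1\,\mathsf{AND}\,P_2)$, $(P_1\,\mathsf{UNION}\,P_2)$, $(P_1\,\mathsf{OPT}\,P_2)$, $(P_1\,\mathsf{FILTER}\,R)$, $(\mathsf{GRAPH}\ c\ P_1)$ with $c\in\mathcal U\cup\mathcal V$, $(P_1\,\mathsf{BIND}(e\,\mathsf{AS}\,?v))$ with $e\in\mathcal U\cup\mathcal L\cup\mathcal V$ and $?v$ not occurring in $P_1$. Filter conditions are Boolean combinations of $\mathrm{bound}(?x)$, $?x=c$, $?x=?y$ (atoms with an unbound variable are false). Evaluation $[\![P]\!]^{\mathfrak D}_G$: $[\![B]\!]=\{\mu\mid\mathrm{dom}(\mu)=\mathrm{var}(B),\mu[B]\subseteq G\}$; $\mathsf{AND}$ is $\Join$; $\mathsf{UNION}$ is $\cup$; $\mathsf{OPT}$ gives $(\Omega_1\Join\Omega_2)\cup\{\mu\in\Omega_1\mid\text{no }\mu'\in\Omega_2\text{ compatible with }\mu\}$; $\mathsf{FILTER}$ selects the mappings satisfying $R$; $[\![\mathsf{GRAPH}\ u\ P_1]\!]^{\mathfrak D}_G=[\![P_1]\!]^{\mathfrak D}_{G_u}$ ($G_u=\emptyset$ if $u$ is not a name in $\mathfrak D$); $[\![\mathsf{GRAPH}\ ?x\ P_1]\!]^{\mathfrak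 D}_G=\bigcup_{u\text{ name in }\mathfrak D}([\![P_1]\!]^{\mathfrak D}_{G_u}\Join\{\{?x\mapsto u\}\})$; $\mathsf{BIND}$ extends each mapping $\mu$ by $?v\mapsto\mu[e]$ (leaving $\mu$ unchanged if $e$ is an unbound variable). **LDQL.** A link pattern is a tuple in $(\mathcal U\cup\{\_,+\})\times(\mathcal U\cup\{\_,+\})\times(\mathcal U\cup\mathcal L\cup\{\_,+\})$. An edge with label $(\langle x_1,x_2,x_3\rangle,u)$ matches $\langle y_1,y_2,y_3\rangle$ in the context of URI $u_c$ if (1) some $i$ has $y_i=\_$ and $x_i=u$, and (2) for each $i$: $y_i=+$ and $x_i=u_c$, or $y_i=x_i$, or $y_i=\_$. LDQL queries $q$ and link path expressions (LPEs) $lpe$ are given by $q:=\langle lpe,P\rangle\mid(\mathsf{SEED}\ U\ q)\mid(\mathsf{SEED}\ ?v\ q)\mid(q\,\mathsf{AND}\,q)\mid(q\,\mathsf{UNION}\,q)\mid\pi_Vq$, $lpe:=\varepsilon\mid lp\mid lpe/lpe\mid lpe|lpe\mid lpe^*\mid[lpe]\mid\langle ?v,q\rangle$, with $lp$ a link pattern, $P$ a graph pattern, $U$ a finite set of URIs, $V$ a finite set of variables. $\mathrm{dataset}_W(U)$ is the dataset with default graph $\bigcup_{u\in U\cap\mathrm{dom}(adoc)}\mathrm{data}(adoc(u))$ and named graphs $\langle u,\mathrm{data}(adoc(u))\rangle$ for $u\in U\cap\mathrm{dom}(adoc)$. For finite $S\subseteq\mathcal U$: $[\![\langle lpe,P\rangle]\!]^S_W=[\![P]\!]^{\mathfrak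 D}_G$ with $\mathfrak D=\mathrm{dataset}_W(\bigcup_{u\in S}[\![lpe]\!]^u_W)$ and $G$ its default graph; $[\![(\mathsf{SEED}\ U\ q)]\!]^S_W=[\![q]\!]^U_W$; $[\![(\mathsf{SEED}\ ?v\ q)]\!]^S_W=\bigcup_{u\in\mathcal U}([\![q]\!]^{\{u\}}_W\Join\{\{?v\mapsto u\}\})$; $[\![(q_1\,\mathsf{UNION}\,q_2)]\!]^S_W=[\![q_1]\!]^S_W\cup[\![q_2]\!]^S_W$; $[\![(q_1\,\mathsf{AND}\,q_2)]\!]^S_W=[\![q_1]\!]^S_W\Join[\![q_2]\!]^S_W$; $[\![\pi_Vq]\!]^S_W$ consists of the restrictions of the mappings in $[\![q]\!]^S_W$ to $V$. For $u_c\in\mathrm{dom}(adoc)$: $[\![\varepsilon]\!]^{u_c}_W=\{u_c\}$; $[\![lp]\!]^{u_c}_W$ is the set of URIs $u$ such that some edge $\langle adoc(u_c),(t,u),d'\rangle\in\mathcal G_W$ matches $lp$ in the context of $u_c$; $[\![l_1/l_2]\!]^{u_c}_W=\bigcup_{u'\in[\![l_1]\!]^{u_c}_W}[\![l_2]\!]^{u'}_W$; $[\![l_1|l_2]\!]^{u_c}_W$ is the union; $[\![l^*]\!]^{u_c}_W=\{u_c\}\cup[\![l]\!]^{u_c}_W\cup[\![l/l]\!]^{u_c}_W\cup\cdots$; $[\![[l]]\!]^{u_c}_W=\{u_c\}$ if $[\![l]\!]^{u_c}_W\ne\emptyset$, else $\emptyset$; $[\![\langle ?v,q\rangle]\!]^{u_c}_W=\{u\in\mathcal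 U\mid\mu(?v)=u\text{ for some }\mu\in[\![q]\!]^{\{u_c\}}_W\}$. If $u_c\notin\mathrm{dom}(adoc)$ then $[\![lpe]\!]^{u_c}_W=\emptyset$. **Equivalence.** $q\equiv q'$ means $[\![q]\!]^S_W=[\![q']\!]^S_W$ for every Web of Linked Data $W$ and every finite $S\subseteq\mathcal U$. *)

theory Defs
  imports Main "HOL-Library.FSet" "HOL-Library.Infinite_Typeclass"
begin

section \<open>Data model\<close>

text \<open>
  The pairwise disjoint sets of URIs, blank nodes, literals, variables and documents are the
  type parameters \<open>'u\<close>, \<open>'b\<close>, \<open>'l\<close>, \<open>'v\<close> and \<open>'d\<close>. That they are infinite is expressed by the
  sort \<^class>\<open>infinite\<close>, imposed where results are stated.
\<close>

datatype ('u, 'b, 'l) rdf_term = URI 'u | Blank 'b | Lit 'l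

type_synonym ('u, 'b, 'l) triple =
  "('u, 'b, 'l) rdf_term \<times> ('u, 'b, 'l) rdf_term \<times> ('u, 'b, 'l) rdf_term"

definition rdf_triples :: "('u, 'b, 'l) triple set" where
  "rdf_triples = (range URI \<union> range Blank) \<times> range URI \<times> UNIV"

fun triple_terms :: "('u, 'b, 'l) triple \<Rightarrow> ('u, 'b, 'l) rdf_term set" where
  "triple_terms (x1, x2, x3) = {x1, x2, x3}"

definition uris :: "('u, 'b, 'l) triple \<Rightarrow> 'u set" where
  "uris t = {u. URI u \<in> triple_terms t}"

definition blanks :: "('u, 'b, 'l) triple \<Rightarrow> 'b set" where
  "blanks t = {b. Blank b \<in> triple_terms t}"

definition document_data :: "('d \<Rightarrow> ('u, 'b, 'l) triple set) \<Rightarrow> bool" where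
  "document_data data \<longleftrightarrow>
     (\<forall>d. finite (data d) \<and> data d \<subseteq> rdf_triples) \<and>
     (\<forall>d d'. d \<noteq> d' \<longrightarrow> (\<Union>t\<in>data d. blanks t) \<inter> (\<Union>t\<in>data d'. blanks t) = {})"

record ('u, 'd) web =
  docs :: "'d set"
  adoc :: "'u \<rightharpoonup> 'd"

definition web_of_linked_data :: "('u, 'd) web \<Rightarrow> bool" where
  "web_of_linked_data W \<longleftrightarrow> finite (docs W) \<and> ran (adoc W) = docs W"

definition link_graph ::
  "('d \<Rightarrow> ('u, 'b, 'l) triple set) \<Rightarrow> ('u, 'd) web \<Rightarrow>
     ('d \<times> (('u, 'b, 'l) triple \<times> 'u) \<times> 'd) set" where
  "link_graph data W =
     {(d, (t, u), d') | d t u d'.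
        d \<in> docs W \<and> t \<in> data d \<and> u \<in> uris t \<and> adoc W u = Some d'}"


section \<open>SPARQL\<close>

text \<open>
  Solution mappings are rendered as maps; all mappings produced by the evaluation functions below
  have a finite domain (see \<open>finite_dom_eval_gp\<close> and \<open>finite_dom_eval_query\<close>).
\<close>

type_synonym ('u, 'b, 'l, 'v) mapping = "'v \<rightharpoonup> ('u, 'b, 'l) rdf_term"

definition compatible :: "('v \<rightharpoonup> 'a) \<Rightarrow> ('v \<rightharpoonup> 'a) \<Rightarrow> bool" where
  "compatible \<mu> \<mu>' \<longleftrightarrow> (\<forall>x \<in> dom \<mu> \<inter> dom \<mu>'. \<mu> x = \<mu>' x)"

definition join :: "('v \<rightharpoonup> 'a) set \<Rightarrow> ('v \<rightharpoonup> 'a) set \<Rightarrow> ('v \<rightharpoonup> 'a) set" (infixl "\<Join>" 70) where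
  "\<Omega>1 \<Join> \<Omega>2 = {\<mu>1 ++ \<mu>2 | \<mu>1 \<mu>2. \<mu>1 \<in> \<Omega>1 \<and> \<mu>2 \<in> \<Omega>2 \<and> compatible \<mu>1 \<mu>2}"

record ('u, 'b, 'l) dataset =
  default_graph :: "('u, 'b, 'l) triple set"
  named_graphs :: "'u \<rightharpoonup> ('u, 'b, 'l) triple set"

text \<open>
  A constant or a variable: \<open>('u, 'v) pat\<close> stands for URIs and variables, and
  \<open>('u + 'l, 'v) pat\<close> for URIs, literals and variables.
\<close>

datatype ('c, 'v) pat = Const 'c | Var 'v

type_synonym ('u, 'l, 'v) triple_pattern =
  "('u + 'l, 'v) pat \<times> ('u, 'v) pat \<times> ('u + 'l, 'v) pat"

fun pat_vars :: "('c, 'v) pat \<Rightarrow> 'v set" where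
  "pat_vars (Const c) = {}"
| "pat_vars (Var x) = {x}"

fun triple_pattern_vars :: "('u, 'l, 'v) triple_pattern \<Rightarrow> 'v set" where
  "triple_pattern_vars (y1, y2, y3) = pat_vars y1 \<union> pat_vars y2 \<union> pat_vars y3"

definition bgp_vars :: "('u, 'l, 'v) triple_pattern set \<Rightarrow> 'v set" where
  "bgp_vars B = (\<Union>tp\<in>B. triple_pattern_vars tp)"

fun const_term :: "'u + 'l \<Rightarrow> ('u, 'b, 'l) rdf_term" where
  "const_term (Inl u) = URI u"
| "const_term (Inr l) = Lit l"

text \<open>
  The application \<open>\<mu>[\<alpha>]\<close>. Its result is again a constant (now an arbitrary RDF term)
  or a variable, the latter if \<open>\<alpha>\<close> is a variable that is unbound in \<open>\<mu>\<close>.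
\<close>

fun subst_pat ::
  "('c \<Rightarrow> ('u, 'b, 'l) rdf_term) \<Rightarrow> ('u, 'b, 'l, 'v) mapping \<Rightarrow> ('c, 'v) pat \<Rightarrow>
     (('u, 'b, 'l) rdf_term, 'v) pat" where
  "subst_pat emb \<mu> (Const c) = Const (emb c)"
| "subst_pat emb \<mu> (Var x) = (case \<mu> x of None \<Rightarrow> Var x | Some a \<Rightarrow> Const a)"

fun subst_triple ::
  "('u, 'b, 'l, 'v) mapping \<Rightarrow> ('u, 'l, 'v) triple_pattern \<Rightarrow>
     (('u, 'b, 'l) rdf_term, 'v) pat \<times> (('u, 'b, 'l) rdf_term, 'v) pat \<times>
     (('u, 'b, 'l) rdf_term, 'v) pat" where
  "subst_triple \<mu> (y1, y2, y3) =
     (subst_pat const_term \<mu> y1, subst_pat URI \<mu> y2, subst_pat const_term \<mu> y3)"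

fun const_triple ::
  "('u, 'b, 'l) triple \<Rightarrow>
     (('u, 'b, 'l) rdf_term, 'v) pat \<times> (('u, 'b, 'l) rdf_term, 'v) pat \<times>
     (('u, 'b, 'l) rdf_term, 'v) pat" where
  "const_triple (x1, x2, x3) = (Const x1, Const x2, Const x3)"

datatype ('u, 'l, 'v) filter_cond =
    FBound 'v
  | FEqConst 'v "'u + 'l"
  | FEqVar 'v 'v
  | FNot "('u, 'l, 'v) filter_cond"
  | FAnd "('u, 'l, 'v) filter_cond" "('u, 'l, 'v) filter_cond"
  | FOr "('u, 'l, 'v) filter_cond" "('u, 'l, 'v) filter_cond"

primrec filter_vars :: "('u, 'l, 'v) filter_cond \<Rightarrow> 'v set" where
  "filter_vars (FBound x) = {x}"
| "filter_vars (FEqConst x c) = {x}"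
| "filter_vars (FEqVar x y) = {x, y}"
| "filter_vars (FNot R) = filter_vars R"
| "filter_vars (FAnd R1 R2) = filter_vars R1 \<union> filter_vars R2"
| "filter_vars (FOr R1 R2) = filter_vars R1 \<union> filter_vars R2"

primrec satisfies :: "('u, 'b, 'l, 'v) mapping \<Rightarrow> ('u, 'l, 'v) filter_cond \<Rightarrow> bool" where
  "satisfies \<mu> (FBound x) \<longleftrightarrow> x \<in> dom \<mu>"
| "satisfies \<mu> (FEqConst x c) \<longleftrightarrow> \<mu> x = Some (const_term c)"
| "satisfies \<mu> (FEqVar x y) \<longleftrightarrow> x \<in> dom \<mu> \<and> y \<in> dom \<mu> \<and> \<mu> x = \<mu> y"
| "satisfies \<mu> (FNot R) \<longleftrightarrow> \<not> satisfies \<mu> R"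
| "satisfies \<mu> (FAnd R1 R2) \<longleftrightarrow> satisfies \<mu> R1 \<and> satisfies \<mu> R2"
| "satisfies \<mu> (FOr R1 R2) \<longleftrightarrow> satisfies \<mu> R1 \<or> satisfies \<mu> R2"

datatype ('u, 'l, 'v) graph_pattern =
    PBgp "('u, 'l, 'v) triple_pattern fset"
  | PAnd "('u, 'l, 'v) graph_pattern" "('u, 'l, 'v) graph_pattern"
  | PUnion "('u, 'l, 'v) graph_pattern" "('u, 'l, 'v) graph_pattern"
  | POpt "('u, 'l, 'v) graph_pattern" "('u, 'l, 'v) graph_pattern"
  | PFilter "('u, 'l, 'v) graph_pattern" "('u, 'l, 'v) filter_cond"
  | PGraph "('u, 'v) pat" "('u, 'l, 'v) graph_pattern"
  | PBind "('u, 'l, 'v) graph_pattern" "('u + 'l, 'v) pat" 'v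

primrec gp_vars :: "('u, 'l, 'v) graph_pattern \<Rightarrow> 'v set" where
  "gp_vars (PBgp B) = bgp_vars (fset B)"
| "gp_vars (PAnd P1 P2) = gp_vars P1 \<union> gp_vars P2"
| "gp_vars (PUnion P1 P2) = gp_vars P1 \<union> gp_vars P2"
| "gp_vars (POpt P1 P2) = gp_vars P1 \<union> gp_vars P2"
| "gp_vars (PFilter P R) = gp_vars P \<union> filter_vars R"
| "gp_vars (PGraph c P) = pat_vars c \<union> gp_vars P"
| "gp_vars (PBind P e v) = gp_vars P \<union> pat_vars e \<union> {v}"

text \<open>The only syntactic side condition not enforced by the types is the one on \<open>BIND\<close>.\<close>

primrec wf_gp :: "('u, 'l, 'v) graph_pattern \<Rightarrow> bool" where
  "wf_gp (PBgp B) \<longleftrightarrow> True"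
| "wf_gp (PAnd P1 P2) \<longleftrightarrow> wf_gp P1 \<and> wf_gp P2"
| "wf_gp (PUnion P1 P2) \<longleftrightarrow> wf_gp P1 \<and> wf_gp P2"
| "wf_gp (POpt P1 P2) \<longleftrightarrow> wf_gp P1 \<and> wf_gp P2"
| "wf_gp (PFilter P R) \<longleftrightarrow> wf_gp P"
| "wf_gp (PGraph c P) \<longleftrightarrow> wf_gp P"
| "wf_gp (PBind P e v) \<longleftrightarrow> wf_gp P \<and> v \<notin> gp_vars P"

primrec eval_gp ::
  "('u, 'b, 'l) dataset \<Rightarrow> ('u, 'l, 'v) graph_pattern \<Rightarrow> ('u, 'b, 'l) triple set \<Rightarrow>
     ('u, 'b, 'l, 'v) mapping set" where
  "eval_gp D (PBgp B) G =
     {\<mu>. dom \<mu> = bgp_vars (fset B) \<and> subst_triple \<mu> ` fset B \<subseteq> const_triple ` G}"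
| "eval_gp D (PAnd P1 P2) G = eval_gp D P1 G \<Join> eval_gp D P2 G"
| "eval_gp D (PUnion P1 P2) G = eval_gp D P1 G \<union> eval_gp D P2 G"
| "eval_gp D (POpt P1 P2) G =
     (eval_gp D P1 G \<Join> eval_gp D P2 G) \<union>
     {\<mu> \<in> eval_gp D P1 G. \<not> (\<exists>\<mu>' \<in> eval_gp D P2 G. compatible \<mu> \<mu>')}"
| "eval_gp D (PFilter P R) G = {\<mu> \<in> eval_gp D P G. satisfies \<mu> R}"
| "eval_gp D (PGraph c P) G =
     (case c of
        Const u \<Rightarrow> eval_gp D P (case named_graphs D u of None \<Rightarrow> {} | Some Gu \<Rightarrow> Gu)
      | Var x \<Rightarrow> (\<Union>u \<in> dom (named_graphs D).
                   eval_gp D P (the (named_graphs D u)) \<Join> {[x \<mapsto> URI u]}))"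
| "eval_gp D (PBind P e v) G =
     (\<lambda>\<mu>. case subst_pat const_term \<mu> e of Const a \<Rightarrow> \<mu>(v \<mapsto> a) | Var x \<Rightarrow> \<mu>) ` eval_gp D P G"


section \<open>LDQL\<close>

text \<open>\<open>Wildcard\<close> is the symbol \<open>_\<close> and \<open>Context\<close> the symbol \<open>+\<close>.\<close>

datatype 'a lp_component = Exactly 'a | Wildcard | Context

type_synonym ('u, 'l) link_pattern =
  "'u lp_component \<times> 'u lp_component \<times> ('u + 'l) lp_component"

fun lp_components ::
  "('u, 'l) link_pattern \<Rightarrow>
     ('u, 'b, 'l) rdf_term lp_component \<times> ('u, 'b, 'l) rdf_term lp_component \<times>
     ('u, 'b, 'l) rdf_term lp_component" where
  "lp_components (y1, y2, y3) =
     (map_lp_component URI y1, map_lp_component URI y2, map_lp_component const_term y3)"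

definition component_matches ::
  "'u \<Rightarrow> ('u, 'b, 'l) rdf_term \<Rightarrow> ('u, 'b, 'l) rdf_term lp_component \<Rightarrow> bool" where
  "component_matches uc x y \<longleftrightarrow> (y = Context \<and> x = URI uc) \<or> y = Exactly x \<or> y = Wildcard"

definition link_matches ::
  "('u, 'b, 'l) triple \<times> 'u \<Rightarrow> ('u, 'l) link_pattern \<Rightarrow> 'u \<Rightarrow> bool" where
  "link_matches label lp uc \<longleftrightarrow>
     (case label of ((x1, x2, x3), u) \<Rightarrow> case lp_components lp of (y1, y2, y3) \<Rightarrow>
       ((y1 = Wildcard \<and> x1 = URI u) \<or> (y2 = Wildcard \<and> x2 = URI u) \<or>
        (y3 = Wildcard \<and> x3 = URI u)) \<and>
       component_matches uc x1 y1 \<and> component_matches uc x2 y2 \<and> component_matches uc x3 y3)"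

datatype ('u, 'l, 'v) query =
    QBasic "('u, 'l, 'v) lpe" "('u, 'l, 'v) graph_pattern"
  | QSeed "'u fset" "('u, 'l, 'v) query"
  | QSeedVar 'v "('u, 'l, 'v) query"
  | QAnd "('u, 'l, 'v) query" "('u, 'l, 'v) query"
  | QUnion "('u, 'l, 'v) query" "('u, 'l, 'v) query"
  | QProj "'v fset" "('u, 'l, 'v) query"
and ('u, 'l, 'v) lpe =
    LEps
  | LLink "('u, 'l) link_pattern"
  | LSeq "('u, 'l, 'v) lpe" "('u, 'l, 'v) lpe"
  | LAlt "('u, 'l, 'v) lpe" "('u, 'l, 'v) lpe"
  | LStar "('u, 'l, 'v) lpe"
  | LTest "('u, 'l, 'v) lpe"
  | LQuery 'v "('u, 'l, 'v) query"

primrec wf_query :: "('u, 'l, 'v) query \<Rightarrow> bool"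
  and wf_lpe :: "('u, 'l, 'v) lpe \<Rightarrow> bool" where
  "wf_query (QBasic l P) \<longleftrightarrow> wf_lpe l \<and> wf_gp P"
| "wf_query (QSeed U q) \<longleftrightarrow> wf_query q"
| "wf_query (QSeedVar v q) \<longleftrightarrow> wf_query q"
| "wf_query (QAnd q1 q2) \<longleftrightarrow> wf_query q1 \<and> wf_query q2"
| "wf_query (QUnion q1 q2) \<longleftrightarrow> wf_query q1 \<and> wf_query q2"
| "wf_query (QProj V q) \<longleftrightarrow> wf_query q"
| "wf_lpe LEps \<longleftrightarrow> True"
| "wf_lpe (LLink lp) \<longleftrightarrow> True"
| "wf_lpe (LSeq l1 l2) \<longleftrightarrow> wf_lpe l1 \<and> wf_lpe l2"
| "wf_lpe (LAlt l1 l2) \<longleftrightarrow> wf_lpe l1 \<and> wf_lpe l2"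
| "wf_lpe (LStar l) \<longleftrightarrow> wf_lpe l"
| "wf_lpe (LTest l) \<longleftrightarrow> wf_lpe l"
| "wf_lpe (LQuery v q) \<longleftrightarrow> wf_query q"

definition web_dataset ::
  "('d \<Rightarrow> ('u, 'b, 'l) triple set) \<Rightarrow> ('u, 'd) web \<Rightarrow> 'u set \<Rightarrow> ('u, 'b, 'l) dataset" where
  "web_dataset data W U =
     \<lparr>default_graph = (\<Union>u \<in> U \<inter> dom (adoc W). data (the (adoc W u))),
      named_graphs = (\<lambda>u. if u \<in> U then map_option data (adoc W u) else None)\<rparr>"

text \<open>
  \<open>iterate f n\<close> is the \<open>n\<close>-fold sequential composition of \<open>f\<close>; note that the iterate for
  \<open>n = 1\<close> is \<open>f\<close> itself.
\<close>

primrec iterate :: "('u \<Rightarrow> 'u set) \<Rightarrow> nat \<Rightarrow> 'u \<Rightarrow> 'u set" where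
  "iterate f 0 u = {u}"
| "iterate f (Suc n) u = (\<Union>u' \<in> f u. iterate f n u')"

primrec eval_query ::
    "('d \<Rightarrow> ('u, 'b, 'l) triple set) \<Rightarrow> ('u, 'd) web \<Rightarrow> ('u, 'l, 'v) query \<Rightarrow> 'u set \<Rightarrow>
       ('u, 'b, 'l, 'v) mapping set"
  and eval_lpe ::
    "('d \<Rightarrow> ('u, 'b, 'l) triple set) \<Rightarrow> ('u, 'd) web \<Rightarrow> ('u, 'l, 'v) lpe \<Rightarrow> 'u \<Rightarrow> 'u set" where
  "eval_query data W (QBasic l P) S =
     (let D = web_dataset data W (\<Union>u\<in>S. eval_lpe data W l u) in eval_gp D P (default_graph D))"
| "eval_query data W (QSeed U q) S = eval_query data W q (fset U)"
| "eval_query data W (QSeedVar v q) S = (\<Union>u. eval_query data W q {u} \<Join> {[v \<mapsto> URI u]})"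
| "eval_query data W (QAnd q1 q2) S = eval_query data W q1 S \<Join> eval_query data W q2 S"
| "eval_query data W (QUnion q1 q2) S = eval_query data W q1 S \<union> eval_query data W q2 S"
| "eval_query data W (QProj V q) S = (\<lambda>\<mu>. \<mu> |` fset V) ` eval_query data W q S"
| "eval_lpe data W LEps uc = (if uc \<in> dom (adoc W) then {uc} else {})"
| "eval_lpe data W (LLink lp) uc =
     (if uc \<in> dom (adoc W)
      then {u. \<exists>t d'. (the (adoc W uc), (t, u), d') \<in> link_graph data W \<and> link_matches (t, u) lp uc}
      else {})"
| "eval_lpe data W (LSeq l1 l2) uc =
     (if uc \<in> dom (adoc W) then (\<Union>u' \<in> eval_lpe data W l1 uc. eval_lpe data W l2 u') else {})"
| "eval_lpe data W (LAlt l1 l2) uc =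
     (if uc \<in> dom (adoc W) then eval_lpe data W l1 uc \<union> eval_lpe data W l2 uc else {})"
| "eval_lpe data W (LStar l) uc =
     (if uc \<in> dom (adoc W) then (\<Union>n. iterate (eval_lpe data W l) n uc) else {})"
| "eval_lpe data W (LTest l) uc =
     (if uc \<in> dom (adoc W) \<and> eval_lpe data W l uc \<noteq> {} then {uc} else {})"
| "eval_lpe data W (LQuery v q) uc =
     (if uc \<in> dom (adoc W)
      then {u. \<exists>\<mu> \<in> eval_query data W q {uc}. \<mu> v = Some (URI u)} else {})"

definition ldql_equiv ::
  "('d \<Rightarrow> ('u, 'b, 'l) triple set) \<Rightarrow> ('u, 'l, 'v) query \<Rightarrow> ('u, 'l, 'v) query \<Rightarrow> bool" where
  "ldql_equiv data q q' \<longleftrightarrow>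
     (\<forall>W S. web_of_linked_data W \<and> finite S \<longrightarrow> eval_query data W q S = eval_query data W q' S)"


section \<open>Finiteness of the domains of solution mappings\<close>

lemma finite_pat_vars: "finite (pat_vars p)"
  by (cases p) auto

lemma finite_bgp_vars: "finite (bgp_vars (fset B))"
  by (auto simp: bgp_vars_def finite_pat_vars)

lemma finite_dom_join:
  assumes "\<mu> \<in> A \<Join> B" "\<And>\<mu>. \<mu> \<in> A \<Longrightarrow> finite (dom \<mu>)" "\<And>\<mu>. \<mu> \<in> B \<Longrightarrow> finite (dom \<mu>)"
  shows "finite (dom \<mu>)"
  using assms by (auto simp: join_def)

lemma finite_dom_eval_gp: "\<mu> \<in> eval_gp D P G \<Longrightarrow> finite (dom \<mu>)"
proof (induction P arbitrary: \<mu> G)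
  case (PBgp B)
  then show ?case by (simp add: finite_bgp_vars)
next
  case (PGraph c P)
  then show ?case by (cases c) (auto elim!: finite_dom_join)
next
  case (PBind P e v)
  then show ?case by (auto split: pat.splits)
qed (auto elim: finite_dom_join)

lemma finite_dom_eval_query:
  fixes q :: "('u, 'l, 'v) query"
  shows "\<mu> \<in> eval_query data W q S \<Longrightarrow> finite (dom \<mu>)"
proof -
  have "\<forall>\<mu> S. \<mu> \<in> eval_query data W q S \<longrightarrow> finite (dom \<mu>)"
    by (rule query.induct[where ?P2.0 = "\<lambda>_. True"])
      (auto simp: Let_def dest: finite_dom_eval_gp elim!: finite_dom_join)
  then show "\<mu> \<in> eval_query data W q S \<Longrightarrow> finite (dom \<mu>)" by blast
qed

end

theory Submission imports Defs begin

text \<open>Under set semantics UNION is plain set union, and each other operator involved acts on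
  solution mappings one at a time (or, for a join, one pair at a time), so it commutes with
  unions.\<close>

lemma join_Un_left: "(A \<union> B) \<Join> C = (A \<Join> C) \<union> (B \<Join> C)"
  unfolding join_def by blast

lemma join_Un_right: "A \<Join> (B \<union> C) = (A \<Join> B) \<union> (A \<Join> C)"
  unfolding join_def by blast

theorem lemma2:
  fixes data :: "'d::infinite \<Rightarrow> ('u::infinite, 'b::infinite, 'l::infinite) triple set"
    and q1 q2 q3 :: "('u, 'l, 'v::infinite) query"
    and V :: "'v fset" and U :: "'u fset" and v :: 'v
  assumes "document_data data"
    and "wf_query q1" and "wf_query q2" and "wf_query q3"
  shows
    "ldql_equiv data (QAnd q1 (QUnion q2 q3)) (QUnion (QAnd q1 q2) (QAnd q1 q3)) \<and>
     ldql_equiv data (QProj V (QUnion q1 q2)) (QUnion (QProj V q1) (QProj V q2)) \<and>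
     ldql_equiv data (QSeed U (QUnion q1 q2)) (QUnion (QSeed U q1) (QSeed U q2)) \<and>
     ldql_equiv data (QSeedVar v (QUnion q1 q2)) (QUnion (QSeedVar v q1) (QSeedVar v q2))"
  \<comment> \<open>\<open>QProj\<close> is an image; \<open>QSeed\<close> only changes the seed
    set, so its case is immediate; \<open>QSeedVar\<close> distributes the join for each
    \<open>u\<close>, then splits the union over all \<open>u\<close>.\<close>
  by (simp add: ldql_equiv_def join_Un_left join_Un_right image_Un UN_Un_distrib)

end
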